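(* All the functions $F_I(p)$, $I\subset J$, $|I|=k-1$, and $G_I(z,p)$, $I\subset J$, $|I|=k+1$, are pairwise in involution, that is, the Poisson bracket of any two of them is zero.
   Context: Let $n>k$ be positive integers, $J=\{1,\dots,n\}$. Fix numbers $b_j^m\in\mathbb C$, $j\in J$, $m=1,\dots,k$, and put $d_{i_1,\dots,i_k}=\det_{\ell,m=1}^k(b^m_{i_\ell})$. Assume $d_{i_1,\dots,i_k}\neq0$ whenever $i_1,\dots,i_k\in J$ are distinct. Fix nonzero weights $a_j\in\mathbb C^\times$, $j\in J$, with $\sum_{j\in J}a_j\neq0$. Let $z_1,\dots,z_n,p_1,\dots,p_n$ be the dual coordinates on $T^*(\mathbb C^n)$, with the standard Poisson bracket $$\{M,N\}=\sum_{j=1}^n\Big(\frac{\partial M}{\partial z_j}\frac{\partial N}{\partial p_j}-\frac{\partial M}{\partial p_j}\frac{\partial N}{\partial z_j}\Big),$$ applied to functions regular on the open subset of $T^*(\mathbb C^n)$ where all $p_j\neq0$. Functions $M,N$ are in involution if $\{M,N\}=0$. For a subset $I=\{i_1,\dots,i_{k-1}\}$ of $k-1$ distinct elements of $J$, $F_I(p)=\sum_{j\in J}d_{j,i_1,\dots,i_{k-1}}p_j$. For a subset $I=\{i_1,\dots,i_{k+1}\}$ of $k+1$ distinct elements of $J$, $$G_I(z,p)=\sum_{m=1}^{k+1}(-1)^{m-1}d_{i_1,\dots,\widehat{i_m},\dots,i_{k+1}}\Big(z_{i_m}-\frac{a_{i_m}}{p_{i_m}}\Big).$$ (The elements of $I$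 are listed in any fixed order; changing the order changes $F_I$, $G_I$ at most by a sign.) *)

theory Defs
  imports "HOL-Analysis.Analysis" "Jordan_Normal_Form.Determinant"
begin

no_notation Matrix.vec_index (infixl "$" 100)

text \<open>A function on the cotangent bundle of \<open>complex ^ 'n\<close> is curried: \<open>M z p\<close> is its value at the
  point with coordinates \<open>z\<close> and momenta \<open>p\<close>.  The index set of the coordinates is \<open>UNIV :: 'n set\<close>.\<close>

type_synonym 'n phase_fun = "complex ^ 'n \<Rightarrow> complex ^ 'n \<Rightarrow> complex"

definition partial_z :: "'n::finite \<Rightarrow> 'n phase_fun \<Rightarrow> 'n phase_fun" where
  "partial_z j M z p = deriv (\<lambda>t. M (z + axis j t) p) 0"

definition partial_p :: "'n::finite \<Rightarrow> 'n phase_fun \<Rightarrow> 'n phase_fun" where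
  "partial_p j M z p = deriv (\<lambda>t. M z (p + axis j t)) 0"

definition poisson_bracket :: "'n::finite phase_fun \<Rightarrow> 'n phase_fun \<Rightarrow> 'n phase_fun" where
  "poisson_bracket M N z p =
     (\<Sum>j\<in>UNIV. partial_z j M z p * partial_p j N z p - partial_p j M z p * partial_z j N z p)"

text \<open>The functions live on the open subset where all momenta are nonzero; values elsewhere (where
  Isabelle's convention \<open>x / 0 = 0\<close> would enter) are irrelevant.\<close>

definition in_involution :: "'n::finite phase_fun \<Rightarrow> 'n phase_fun \<Rightarrow> bool" where
  "in_involution M N \<longleftrightarrow> (\<forall>z p. (\<forall>j. p $ j \<noteq> 0) \<longrightarrow> poisson_bracket M N z p = 0)"

text \<open>\<open>b j m\<close> is $b_j^m$, used for \<open>1 \<le> m \<le> k\<close>; the matrix indices and the list positions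
  start at \<open>0\<close>.  \<open>dcoef b k is\<close> is meant for lists of length \<open>k\<close>.\<close>

definition dcoef :: "('n \<Rightarrow> nat \<Rightarrow> complex) \<Rightarrow> nat \<Rightarrow> 'n list \<Rightarrow> complex" where
  "dcoef b k is = Determinant.det (Matrix.mat k k (\<lambda>(l, m). b (is ! l) (Suc m)))"

definition F_fun :: "('n::finite \<Rightarrow> nat \<Rightarrow> complex) \<Rightarrow> nat \<Rightarrow> 'n list \<Rightarrow> 'n phase_fun" where
  "F_fun b k is z p = (\<Sum>j\<in>UNIV. dcoef b k (j # is) * p $ j)"

text \<open>With positions counted from \<open>0\<close>, the sign $(-1)^{m-1}$ becomes \<open>(-1) ^ m\<close>.\<close>

definition G_fun ::
  "('n::finite \<Rightarrow> nat \<Rightarrow> complex) \<Rightarrow> nat \<Rightarrow> ('n \<Rightarrow> complex) \<Rightarrow> 'n list \<Rightarrow> 'n phase_fun" where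
  "G_fun b k a is z p =
     (\<Sum>m<k + 1. (-1) ^ m * dcoef b k (take m is @ drop (Suc m) is)
                   * (z $ (is ! m) - a (is ! m) / p $ (is ! m)))"

text \<open>A subset of the index set is given by any listing of its elements without repetition.\<close>

definition FG_functions ::
  "('n::finite \<Rightarrow> nat \<Rightarrow> complex) \<Rightarrow> nat \<Rightarrow> ('n \<Rightarrow> complex) \<Rightarrow> 'n phase_fun set" where
  "FG_functions b k a =
     {F_fun b k is | is. distinct is \<and> length is = k - 1} \<union>
     {G_fun b k a is | is. distinct is \<and> length is = k + 1}"

text \<open>\<^const>\<open>deriv\<close> is only meaningful for differentiable functions.  The members of
  \<^const>\<open>FG_functions\<close> do have all partial derivatives where the momenta are nonzero.\<close>

lemma FG_functions_partial_differentiable: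
  assumes "M \<in> FG_functions b k a" and "\<And>j. p $ j \<noteq> 0"
  shows "(\<lambda>t. M (z + axis j t) p) field_differentiable at 0"
    and "(\<lambda>t. M z (p + axis j t)) field_differentiable at 0"
proof -
  have ax: "(\<lambda>t. axis j t $ i) field_differentiable at (0::complex)" for i :: 'a
    by (cases "i = j") (auto simp: axis_def)
  have ax0: "axis j (0::complex) $ i = 0" for i :: 'a
    by (simp add: axis_def)
  show "(\<lambda>t. M (z + axis j t) p) field_differentiable at 0"
    using assms unfolding FG_functions_def F_fun_def G_fun_def
    by (auto intro!: derivative_intros field_differentiable_sum field_differentiable_mult
        field_differentiable_add field_differentiable_diff ax)
  show "(\<lambda>t. M z (p + axis j t)) field_differentiable at 0"
    using assms unfolding FG_functions_def F_fun_def G_fun_def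
    by (auto intro!: derivative_intros field_differentiable_sum field_differentiable_mult
        field_differentiable_add field_differentiable_diff field_differentiable_divide ax simp: ax0)
qed

end

theory Submission
  imports Defs
begin

text \<open>The substitution \<open>w\<^sub>j = z\<^sub>j - a\<^sub>j / p\<^sub>j\<close> is canonical: it only shifts each position
  by a function of its own momentum, so the pairs \<open>(w\<^sub>j, p\<^sub>j)\<close> have the same brackets as the pairs
  \<open>(z\<^sub>j, p\<^sub>j)\<close>.  In these coordinates \<open>F\<^sub>I\<close> is a linear form in \<open>p\<close> and \<open>G\<^sub>I\<close> is a linear form
  in \<open>w\<close>, both with constant coefficients.  Hence two functions \<open>F\<close> commute, two functions \<open>G\<close>
  commute, and the bracket of \<open>G\<^sub>I\<close> with \<open>F\<^sub>K\<close> is the pairing of their coefficient vectors,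
  \[ \sum_{m} (-1)^{m-1} d_{i_1,\dots,\widehat{i_m},\dots,i_{k+1}}\, d_{i_m,K} , \]
  whose vanishing is a Pluecker relation.

  The Pluecker relation holds because \<open>d\<^bsub>j,K\<^esub>\<close> depends linearly on the vector \<open>b\<^sub>j\<close>, and
  Cramer's rule gives the linear dependence
  \[ \sum_{m} (-1)^{m-1} d_{i_1,\dots,\widehat{i_m},\dots,i_{k+1}}\, b_{i_m} = 0 \]
  between any \<open>k + 1\<close> vectors of a space of dimension \<open>k\<close>.  The lemmas
  \<open>bracket_shifted_linear\<close>, \<open>cramer_dependence\<close> and \<open>pluecker_relation\<close> carry these steps.\<close>

definition shifted_linear ::
  "('n::finite \<Rightarrow> complex) \<Rightarrow> ('n \<Rightarrow> complex) \<Rightarrow> ('n \<Rightarrow> complex) \<Rightarrow> 'n phase_fun" where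
  "shifted_linear a c e z p = (\<Sum>i\<in>UNIV. c i * (z $ i - a i / p $ i) + e i * p $ i)"

lemma partial_z_shifted_linear: "partial_z j (shifted_linear a c e) z p = c j"
proof -
  have "((\<lambda>t. c i * ((z + axis j t) $ i - a i / p $ i) + e i * p $ i)
      has_field_derivative (if i = j then c i else 0)) (at 0)" for i
    by (cases "i = j") (auto simp: axis_def intro!: derivative_eq_intros)
  then have "((\<lambda>t. shifted_linear a c e (z + axis j t) p)
      has_field_derivative (\<Sum>i\<in>UNIV. if i = j then c i else 0)) (at 0)"
    unfolding shifted_linear_def by (intro DERIV_sum) auto
  then show ?thesis
    unfolding partial_z_def by (auto dest: DERIV_imp_deriv)
qed

lemma partial_p_shifted_linear:
  assumes "p $ j \<noteq> 0"
  shows "partial_p j (shifted_linear a c e) z p = c j * a j / (p $ j)\<^sup>2 + e j"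
proof -
  have "((\<lambda>t. c i * (z $ i - a i / (p + axis j t) $ i) + e i * (p + axis j t) $ i)
      has_field_derivative (if i = j then c i * a i / (p $ i)\<^sup>2 + e i else 0)) (at 0)" for i
    using assms
    by (cases "i = j")
      (auto simp: axis_def power2_eq_square intro!: derivative_eq_intros)
  then have "((\<lambda>t. shifted_linear a c e z (p + axis j t))
      has_field_derivative (\<Sum>i\<in>UNIV. if i = j then c i * a i / (p $ i)\<^sup>2 + e i else 0)) (at 0)"
    unfolding shifted_linear_def by (intro DERIV_sum) auto
  then show ?thesis
    unfolding partial_p_def by (auto dest: DERIV_imp_deriv)
qed

text \<open>The terms \<open>a\<^sub>j / p\<^sub>j\<^sup>2\<close> cancel because they enter the bracket symmetrically in \<open>c\<close> and \<open>c'\<close>: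
  this is the statement that the shift of the positions is canonical.\<close>

lemma bracket_shifted_linear:
  assumes "\<And>j. p $ j \<noteq> 0"
  shows "poisson_bracket (shifted_linear a c e) (shifted_linear a c' e') z p
       = (\<Sum>j\<in>UNIV. c j * e' j - e j * c' j)"
  unfolding poisson_bracket_def
  by (intro sum.cong refl)
    (simp add: partial_z_shifted_linear partial_p_shifted_linear assms algebra_simps)

lemma F_fun_shifted_linear:
  "F_fun b k ks = shifted_linear a (\<lambda>j. 0) (\<lambda>j. dcoef b k (j # ks))"
  by (intro ext) (simp add: F_fun_def shifted_linear_def)

text \<open>The functions \<open>G\<^sub>I\<close> are given as sums over positions of the list, the brackets as
  sums over indices.  \<open>G_coeff\<close> is the coefficient of \<open>w\<^sub>j\<close> in \<open>G\<^sub>I\<close>, obtained by collecting the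
  positions that hold \<open>j\<close>.\<close>

definition G_coeff :: "('n \<Rightarrow> nat \<Rightarrow> complex) \<Rightarrow> nat \<Rightarrow> 'n list \<Rightarrow> 'n \<Rightarrow> complex" where
  "G_coeff b k xs j =
     (\<Sum>m<k + 1. if xs ! m = j then (-1) ^ m * dcoef b k (take m xs @ drop (Suc m) xs) else 0)"

lemma sum_G_coeff:
  fixes b :: "'n::finite \<Rightarrow> nat \<Rightarrow> complex"
  shows "(\<Sum>j\<in>UNIV. G_coeff b k xs j * h j)
       = (\<Sum>m<k + 1. (-1) ^ m * dcoef b k (take m xs @ drop (Suc m) xs) * h (xs ! m))"
proof -
  have "(\<Sum>j\<in>UNIV. G_coeff b k xs j * h j)
      = (\<Sum>j\<in>UNIV. \<Sum>m<k + 1. if xs ! m = j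
            then (-1) ^ m * dcoef b k (take m xs @ drop (Suc m) xs) * h j else 0)"
    unfolding G_coeff_def sum_distrib_right by (intro sum.cong refl) auto
  also have "\<dots> = (\<Sum>m<k + 1. \<Sum>j\<in>UNIV. if xs ! m = j
            then (-1) ^ m * dcoef b k (take m xs @ drop (Suc m) xs) * h j else 0)"
    by (rule sum.swap)
  finally show ?thesis
    by simp
qed

lemma G_fun_shifted_linear: "G_fun b k a xs = shifted_linear a (G_coeff b k xs) (\<lambda>j. 0)"
  by (intro ext) (simp add: G_fun_def shifted_linear_def sum_G_coeff del: sum.lessThan_Suc)

text \<open>The left-hand side is the expansion, along its first column, of the
  \<open>(k + 1) \<times> (k + 1)\<close> determinant whose rows are the vectors \<open>b\<close> at the entries of \<open>xs\<close>, each
  preceded by a copy of its coordinate \<open>Suc q\<close>.  Two of its columns are equal.\<close>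

lemma cramer_dependence:
  assumes len: "length xs = k + 1" and q: "q < k"
  shows "(\<Sum>m<k + 1. (-1) ^ m * dcoef b k (take m xs @ drop (Suc m) xs) * b (xs ! m) (Suc q)) = 0"
proof -
  define A where "A = Matrix.mat (k + 1) (k + 1)
    (\<lambda>(l, m). if m = 0 then b (xs ! l) (Suc q) else b (xs ! l) m)"
  have A: "A \<in> carrier_mat (k + 1) (k + 1)"
    by (simp add: A_def)
  have minor: "mat_delete A m 0
      = Matrix.mat k k (\<lambda>(l, i). b ((take m xs @ drop (Suc m) xs) ! l) (Suc i))"
    if "m < k + 1" for m
  proof (rule eq_matI)
    fix l i
    assume "l < dim_row (Matrix.mat k k (\<lambda>(l, i). b ((take m xs @ drop (Suc m) xs) ! l) (Suc i)))"
      and "i < dim_col (Matrix.mat k k (\<lambda>(l, i). b ((take m xs @ drop (Suc m) xs) ! l) (Suc i)))"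
    then have li: "l < k" "i < k" by auto
    have "(take m xs @ drop (Suc m) xs) ! l = (if l < m then xs ! l else xs ! Suc l)"
      using that li len by (auto simp: nth_append min_def)
    then show "mat_delete A m 0 $$ (l, i)
        = Matrix.mat k k (\<lambda>(l, i). b ((take m xs @ drop (Suc m) xs) ! l) (Suc i)) $$ (l, i)"
      using that li by (simp add: mat_delete_def A_def)
  qed (simp_all add: A_def mat_delete_def)
  have "Determinant.det A = 0"
  proof (rule det_identical_columns[OF A, of 0 "Suc q"])
    show "Matrix.col A 0 = Matrix.col A (Suc q)"
      using q by (intro eq_vecI) (auto simp: A_def)
  qed (use q in auto)
  moreover have "Determinant.det A = (\<Sum>m<k + 1. A $$ (m, 0) * cofactor A m 0)"
    by (rule laplace_expansion_column[OF A]) simp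
  moreover have "A $$ (m, 0) * cofactor A m 0
      = (-1) ^ m * dcoef b k (take m xs @ drop (Suc m) xs) * b (xs ! m) (Suc q)"
    if "m < k + 1" for m
    unfolding cofactor_def minor[OF that] dcoef_def using that by (simp add: A_def)
  ultimately show ?thesis
    by (simp del: sum.lessThan_Suc)
qed

text \<open>Laplace expansion along the first row: the minors only see the rows \<open>ks\<close>.\<close>

lemma dcoef_linear_first:
  fixes b :: "'n \<Rightarrow> nat \<Rightarrow> complex"
  assumes "0 < k"
  obtains C where "\<And>j. dcoef b k (j # ks) = (\<Sum>q<k. C q * b j (Suc q))"
proof -
  define A where "A = (\<lambda>j. Matrix.mat k k (\<lambda>(l, m). b ((j # ks) ! l) (Suc m)))"
  \<comment> \<open>The cofactors along the first row are the same for all \<open>j\<close>, so they are taken at an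
    arbitrary index.\<close>
  have "dcoef b k (j # ks) = (\<Sum>q<k. cofactor (A undefined) 0 q * b j (Suc q))" for j
  proof -
    have "A j \<in> carrier_mat k k"
      by (simp add: A_def)
    then have "dcoef b k (j # ks) = (\<Sum>q<k. A j $$ (0, q) * cofactor (A j) 0 q)"
      unfolding dcoef_def using assms
      by (subst laplace_expansion_row[of _ k 0]) (auto simp: A_def)
    also have "\<dots> = (\<Sum>q<k. cofactor (A undefined) 0 q * b j (Suc q))"
    proof (intro sum.cong refl)
      fix q assume "q \<in> {..<k}"
      moreover have "mat_delete (A j) 0 q = mat_delete (A undefined) 0 q"
        by (intro eq_matI) (auto simp: A_def mat_delete_def)
      ultimately show "A j $$ (0, q) * cofactor (A j) 0 q = cofactor (A undefined) 0 q * b j (Suc q)"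
        using assms by (simp add: cofactor_def A_def)
    qed
    finally show ?thesis .
  qed
  then show thesis
    by (rule that)
qed

lemma pluecker_relation:
  fixes b :: "'n::finite \<Rightarrow> nat \<Rightarrow> complex"
  assumes "0 < k" and len: "length xs = k + 1"
  shows "(\<Sum>j\<in>UNIV. G_coeff b k xs j * dcoef b k (j # ks)) = 0"
proof -
  obtain C where C: "\<And>j. dcoef b k (j # ks) = (\<Sum>q<k. C q * b j (Suc q))"
    using dcoef_linear_first[OF assms(1)] by blast
  have "(\<Sum>j\<in>UNIV. G_coeff b k xs j * dcoef b k (j # ks))
      = (\<Sum>j\<in>UNIV. \<Sum>q<k. C q * (G_coeff b k xs j * b j (Suc q)))"
    by (simp add: C sum_distrib_left mult_ac)
  also have "\<dots> = (\<Sum>q<k. C q * (\<Sum>j\<in>UNIV. G_coeff b k xs j * b j (Suc q)))"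
    by (subst sum.swap) (simp add: sum_distrib_left)
  also have "\<dots> = 0"
    using cramer_dependence[OF len] by (intro sum.neutral) (simp only: sum_G_coeff, simp)
  finally show ?thesis .
qed

theorem theorem3p6:
  fixes b :: "'n::finite \<Rightarrow> nat \<Rightarrow> complex"
    and a :: "'n \<Rightarrow> complex"
    and k :: nat
  assumes "0 < k" and "k < CARD('n)"
    and "\<And>is. distinct is \<Longrightarrow> length is = k \<Longrightarrow> dcoef b k is \<noteq> 0"
    and "\<And>j. a j \<noteq> 0"
    and "(\<Sum>j\<in>UNIV. a j) \<noteq> 0"
  shows "\<forall>M \<in> FG_functions b k a. \<forall>N \<in> FG_functions b k a. in_involution M N"
proof (intro ballI)
  have FF: "in_involution (F_fun b k ks) (F_fun b k ks')" for ks ks'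
    by (simp add: in_involution_def F_fun_shifted_linear[where a = a] bracket_shifted_linear)
  have GG: "in_involution (G_fun b k a xs) (G_fun b k a xs')" for xs xs'
    by (simp add: in_involution_def G_fun_shifted_linear bracket_shifted_linear)
  have GF: "in_involution (G_fun b k a xs) (F_fun b k ks)"
    and FG: "in_involution (F_fun b k ks) (G_fun b k a xs)" if "length xs = k + 1" for xs ks
    using pluecker_relation[OF assms(1) that, of b ks]
    by (simp_all add: in_involution_def F_fun_shifted_linear[where a = a] G_fun_shifted_linear
        bracket_shifted_linear sum_negf mult.commute)
  fix M N
  assume "M \<in> FG_functions b k a" and "N \<in> FG_functions b k a"
  then show "in_involution M N"
    unfolding FG_functions_def by (auto intro: FF GG GF FG)
qed

end
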